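(* Let $q\in\mathbb{C}^\times$ and let $\widetilde{H}$ be the affine Hecke algebra of type $G_2$. The $1$-dimensional representations $\widetilde{H}\to\mathbb{C}$ are: $L_{q,q}$: $T_1\mapsto q$, $T_2\mapsto q$, $X^{\omega_1}\mapsto q^6$, $X^{\omega_2}\mapsto q^{10}$; $L_{q,-q^{-1}}$: $T_1\mapsto q$, $T_2\mapsto-q^{-1}$, $X^{\omega_1}\mapsto q^2$, $X^{\omega_2}\mapsto q^2$; $L_{-q^{-1},q}$: $T_1\mapsto-q^{-1}$, $T_2\mapsto q$, $X^{\omega_1}\mapsto q^{-2}$, $X^{\omega_2}\mapsto q^{-2}$; $L_{-q^{-1},-q^{-1}}$: $T_1\mapsto-q^{-1}$, $T_2\mapsto-q^{-1}$, $X^{\omega_1}\mapsto q^{-6}$, $X^{\omega_2}\mapsto q^{-10}$.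
   Context: The type $G_2$ root system has simple roots $\alpha_1,\alpha_2$ with $\langle\alpha_1,\alpha_2^\vee\rangle=-1$, $\langle\alpha_2,\alpha_1^\vee\rangle=-3$; $s_i\lambda=\lambda-\langle\lambda,\alpha_i^\vee\rangle\alpha_i$. The fundamental weights are $\omega_1=2\alpha_1+\alpha_2$, $\omega_2=3\alpha_1+2\alpha_2$, and $P=\mathbb{Z}\omega_1+\mathbb{Z}\omega_2=\mathbb{Z}\alpha_1+\mathbb{Z}\alpha_2$. $X=\{X^\lambda\mid\lambda\in P\}$ with $X^\lambda X^\mu=X^{\lambda+\mu}$. The affine Hecke algebra $\widetilde{H}$ is the $\mathbb{C}$-algebra generated by $T_1,T_2$ and $X^\lambda$ ($\lambda\in P$), with the group algebra $\mathbb{C}[X]$ a subalgebra, subject to $T_i^2=(q-q^{-1})T_i+1$, $T_1T_2T_1T_2T_1T_2=T_2T_1T_2T_1T_2T_1$, and $X^\lambda T_i=T_iX^{s_i\lambda}+(q-q^{-1})\frac{X^\lambda-X^{s_i\lambda}}{1-X^{-\alpha_i}}$ for $\lambda\in P$, $i=1,2$. *)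

theory Defs
  imports
    Complex_Main
    "HOL-Library.Poly_Mapping"
    "HOL-Library.Product_Plus"
    "HOL-Algebra.QuotRing"
    "HOL-Algebra.Algebraic_Closure_Type"
begin

section \<open>The root datum\<close>

datatype node = N1 | N2

text \<open>The pair \<open>(a, b)\<close> stands for \<open>a \<alpha>\<^sub>1 + b \<alpha>\<^sub>2\<close>. In type \<open>G\<^sub>2\<close> the root lattice is the
  whole weight lattice, so this type is \<open>P\<close>.\<close>

type_synonym weight = "int \<times> int"

fun simple_root :: "node \<Rightarrow> weight" where
  "simple_root N1 = (1, 0)"
| "simple_root N2 = (0, 1)"

text \<open>\<open>pairing \<lambda> i\<close> is \<open>\<langle>\<lambda>, \<alpha>\<^sub>i\<^sup>\<or>\<rangle>\<close>; it extends linearly \<open>\<langle>\<alpha>\<^sub>i, \<alpha>\<^sub>i\<^sup>\<or>\<rangle> = 2\<close>,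
  \<open>\<langle>\<alpha>\<^sub>1, \<alpha>\<^sub>2\<^sup>\<or>\<rangle> = -1\<close> and \<open>\<langle>\<alpha>\<^sub>2, \<alpha>\<^sub>1\<^sup>\<or>\<rangle> = -3\<close>.\<close>

fun pairing :: "weight \<Rightarrow> node \<Rightarrow> int" where
  "pairing (a, b) N1 = 2 * a - 3 * b"
| "pairing (a, b) N2 = - a + 2 * b"

definition wscale :: "int \<Rightarrow> weight \<Rightarrow> weight" where
  "wscale n \<mu> = (n * fst \<mu>, n * snd \<mu>)"

definition simple_refl :: "node \<Rightarrow> weight \<Rightarrow> weight" where
  "simple_refl i \<mu> = \<mu> - wscale (pairing \<mu> i) (simple_root i)"

fun fund_weight :: "node \<Rightarrow> weight" where
  "fund_weight N1 = (2, 1)"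
| "fund_weight N2 = (3, 2)"

lemma pairing_fund_weight: "pairing (fund_weight i) j = (if i = j then 1 else 0)"
  by (cases i; cases j) auto

lemma weight_eq_fund_weights:
  "\<mu> = wscale (pairing \<mu> N1) (fund_weight N1) + wscale (pairing \<mu> N2) (fund_weight N2)"
  by (cases \<mu>) (simp add: wscale_def)

section \<open>The group algebra of the weight lattice\<close>

type_synonym group_alg = "weight \<Rightarrow>\<^sub>0 complex"

definition Xga :: "weight \<Rightarrow> group_alg" where
  "Xga \<mu> = Poly_Mapping.single \<mu> 1"

text \<open>The fraction \<open>(X\<^sup>\<lambda> - X\<^bsup>s\<^sub>i\<lambda>\<^esup>) / (1 - X\<^bsup>-\<alpha>\<^sub>i\<^esup>)\<close>, which is an element of the group algebra.\<close>

definition bl_quot :: "node \<Rightarrow> weight \<Rightarrow> group_alg" where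
  "bl_quot i \<mu> = (THE f. f * (1 - Xga (- simple_root i)) = Xga \<mu> - Xga (simple_refl i \<mu>))"

lemma Xga_add: "Xga (\<mu> + \<nu>) = Xga \<mu> * Xga \<nu>"
  by (simp add: Xga_def mult_single)

lemma Xga_zero: "Xga 0 = 1"
  by (simp add: Xga_def)

lemma Xga_power: "Xga \<mu> ^ n = Xga (wscale (int n) \<mu>)"
proof (induction n)
  case 0
  have "wscale (int 0) \<mu> = 0"
    by (simp add: wscale_def zero_prod_def)
  then show ?case by (simp add: Xga_zero)
next
  case (Suc n)
  have "wscale (int (Suc n)) \<mu> = \<mu> + wscale (int n) \<mu>"
    by (cases \<mu>) (simp add: wscale_def algebra_simps)
  then show ?case using Suc by (simp add: Xga_add)
qed

lemma lookup_mult_Xga: "Poly_Mapping.lookup (f * Xga \<mu>) (\<nu> + \<mu>) = Poly_Mapping.lookup f \<nu>"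
proof -
  have "Poly_Mapping.lookup (f * Xga \<mu>) (\<nu> + \<mu>) = (\<Sum>l. Poly_Mapping.lookup f l when l = \<nu>)"
    unfolding lookup_mult
  proof (rule Sum_any.cong)
    fix l
    have "(\<Sum>r. Poly_Mapping.lookup (Xga \<mu>) r when \<nu> + \<mu> = l + r) = (\<Sum>r. (1 when l = \<nu>) when r = \<mu>)"
      by (rule Sum_any.cong) (auto simp: Xga_def lookup_single when_def)
    then show "Poly_Mapping.lookup f l * (\<Sum>r. Poly_Mapping.lookup (Xga \<mu>) r when \<nu> + \<mu> = l + r)
        = (Poly_Mapping.lookup f l when l = \<nu>)"
      by (simp add: when_def)
  qed
  then show ?thesis by simp
qed

lemma mult_one_minus_Xga_eq_0:
  assumes "f * (1 - Xga (- simple_root i)) = 0"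
  shows "f = 0"
proof (rule ccontr)
  assume "f \<noteq> 0"
  then obtain \<mu> where \<mu>: "Poly_Mapping.lookup f \<mu> \<noteq> 0"
    by (metis lookup_zero poly_mapping_eqI)
  have eq: "f * Xga (- simple_root i) = f"
    using assms by (simp add: algebra_simps)
  have step: "Poly_Mapping.lookup f (\<nu> - simple_root i) = Poly_Mapping.lookup f \<nu>" for \<nu>
    using lookup_mult_Xga[of f "- simple_root i" \<nu>] by (simp add: eq)
  have iter: "Poly_Mapping.lookup f (\<mu> - wscale (int n) (simple_root i)) \<noteq> 0" for n
  proof (induction n)
    case 0
    then show ?case using \<mu> by (simp add: wscale_def flip: zero_prod_def)
  next
    case (Suc n)
    have "\<mu> - wscale (int (Suc n)) (simple_root i)
        = \<mu> - wscale (int n) (simple_root i) - simple_root i"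
      by (cases \<mu>; cases i) (auto simp: wscale_def)
    then show ?case using Suc step by metis
  qed
  have "inj (\<lambda>n. \<mu> - wscale (int n) (simple_root i))"
    by (cases i) (auto simp: inj_def wscale_def)
  moreover have "range (\<lambda>n. \<mu> - wscale (int n) (simple_root i)) \<subseteq> Poly_Mapping.keys f"
    using iter by (auto simp: in_keys_iff)
  ultimately show False
    using finite_keys[of f] by (meson finite_imageD finite_subset infinite_UNIV_nat)
qed

lemma bl_quot_ex1:
  "\<exists>!f. f * (1 - Xga (- simple_root i)) = Xga \<mu> - Xga (simple_refl i \<mu>)"
proof (rule ex_ex1I)
  let ?y = "Xga (- simple_root i)" and ?n = "nat \<bar>pairing \<mu> i\<bar>"
  have geo: "1 - ?y ^ ?n = (\<Sum>k<?n. ?y ^ k) * (1 - ?y)"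
    by (simp add: one_diff_power_eq mult.commute)
  show "\<exists>f. f * (1 - ?y) = Xga \<mu> - Xga (simple_refl i \<mu>)"
  proof (cases "pairing \<mu> i \<ge> 0")
    case True
    have "Xga (simple_refl i \<mu>) = Xga \<mu> * ?y ^ ?n"
      unfolding Xga_power Xga_add[symmetric] using True
      by (cases \<mu>; cases i) (auto simp: simple_refl_def wscale_def)
    then have "Xga \<mu> - Xga (simple_refl i \<mu>) = (Xga \<mu> * (\<Sum>k<?n. ?y ^ k)) * (1 - ?y)"
      by (simp only: mult.assoc geo[symmetric]) (simp add: algebra_simps)
    then show ?thesis by metis
  next
    case False
    have "Xga \<mu> = Xga (simple_refl i \<mu>) * ?y ^ ?n"
      unfolding Xga_power Xga_add[symmetric] using False
      by (cases \<mu>; cases i) (auto simp: simple_refl_def wscale_def)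
    then have "Xga \<mu> - Xga (simple_refl i \<mu>)
        = - (Xga (simple_refl i \<mu>) * (1 - ?y ^ ?n))"
      by (simp add: algebra_simps)
    then have "Xga \<mu> - Xga (simple_refl i \<mu>)
        = (- (Xga (simple_refl i \<mu>) * (\<Sum>k<?n. ?y ^ k))) * (1 - ?y)"
      unfolding geo by (simp add: mult.assoc)
    then show ?thesis by metis
  qed
next
  fix f g
  assume "f * (1 - Xga (- simple_root i)) = Xga \<mu> - Xga (simple_refl i \<mu>)"
    and "g * (1 - Xga (- simple_root i)) = Xga \<mu> - Xga (simple_refl i \<mu>)"
  then have "(f - g) * (1 - Xga (- simple_root i)) = 0"
    by (simp add: left_diff_distrib)
  then show "f = g"
    using mult_one_minus_Xga_eq_0 by fastforce
qed

lemma bl_quot: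
  "bl_quot i \<mu> * (1 - Xga (- simple_root i)) = Xga \<mu> - Xga (simple_refl i \<mu>)"
  unfolding bl_quot_def by (rule theI'[OF bl_quot_ex1])

section \<open>The free algebra on the generators\<close>

text \<open>Words under concatenation form the free monoid. With this instance the type
  \<open>gen list \<Rightarrow>\<^sub>0 complex\<close>, multiplied by convolution, is the free (noncommutative) \<open>\<complex>\<close>-algebra.\<close>

instantiation list :: (type) monoid_add
begin

definition zero_list :: "'a list" where "zero_list = []"
definition plus_list :: "'a list \<Rightarrow> 'a list \<Rightarrow> 'a list" where "plus_list = append"

instance
  by standard (simp_all add: zero_list_def plus_list_def)

end

datatype gen = GT node | GX weight

type_synonym free_alg = "gen list \<Rightarrow>\<^sub>0 complex"

definition scal :: "complex \<Rightarrow> free_alg" where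
  "scal c = Poly_Mapping.single [] c"

definition fT :: "node \<Rightarrow> free_alg" where
  "fT i = Poly_Mapping.single [GT i] 1"

definition fX :: "weight \<Rightarrow> free_alg" where
  "fX \<mu> = Poly_Mapping.single [GX \<mu>] 1"

text \<open>The linear map sending \<open>X\<^sup>\<lambda>\<close> in the group algebra to the generator \<open>X\<^sup>\<lambda>\<close>.\<close>

definition fX_lin :: "group_alg \<Rightarrow> free_alg" where
  "fX_lin f = (\<Sum>\<mu>\<in>Poly_Mapping.keys f. scal (Poly_Mapping.lookup f \<mu>) * fX \<mu>)"

section \<open>The affine Hecke algebra\<close>

text \<open>Each relation \<open>l = r\<close> is recorded as \<open>l - r\<close>. The first two families say that the \<open>X\<^sup>\<lambda>\<close>
  multiply as in the group algebra.\<close>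

inductive_set hecke_rels :: "complex \<Rightarrow> free_alg set" for q :: complex where
  X_zero: "fX 0 - 1 \<in> hecke_rels q"
| X_add: "fX \<mu> * fX \<nu> - fX (\<mu> + \<nu>) \<in> hecke_rels q"
| quadratic: "fT i * fT i - (scal (q - inverse q) * fT i + 1) \<in> hecke_rels q"
| braid: "fT N1 * fT N2 * fT N1 * fT N2 * fT N1 * fT N2
    - fT N2 * fT N1 * fT N2 * fT N1 * fT N2 * fT N1 \<in> hecke_rels q"
| bernstein: "fX \<mu> * fT i
    - (fT i * fX (simple_refl i \<mu>) + scal (q - inverse q) * fX_lin (bl_quot i \<mu>))
    \<in> hecke_rels q"

abbreviation free_alg_ring :: "free_alg ring" where
  "free_alg_ring \<equiv> ring_of_type_algebra"

definition hecke_ideal :: "complex \<Rightarrow> free_alg set" where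
  "hecke_ideal q = genideal free_alg_ring (hecke_rels q)"

definition hecke :: "complex \<Rightarrow> free_alg set ring" where
  "hecke q = free_alg_ring Quot hecke_ideal q"

definition hecke_class :: "complex \<Rightarrow> free_alg \<Rightarrow> free_alg set" where
  "hecke_class q x = hecke_ideal q +>\<^bsub>free_alg_ring\<^esub> x"

definition hecke_T :: "complex \<Rightarrow> node \<Rightarrow> free_alg set" where
  "hecke_T q i = hecke_class q (fT i)"

definition hecke_X :: "complex \<Rightarrow> weight \<Rightarrow> free_alg set" where
  "hecke_X q \<mu> = hecke_class q (fX \<mu>)"

definition hecke_smult :: "complex \<Rightarrow> complex \<Rightarrow> free_alg set \<Rightarrow> free_alg set" where
  "hecke_smult q c h = hecke_class q (scal c) \<otimes>\<^bsub>hecke q\<^esub> h"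

text \<open>Homomorphisms of unital \<open>\<complex>\<close>-algebras from the Hecke algebra to \<open>\<complex>\<close>. They are taken
  extensional so that two of them are equal as soon as they agree on the carrier.\<close>

definition one_dim_reps :: "complex \<Rightarrow> (free_alg set \<Rightarrow> complex) set" where
  "one_dim_reps q = {\<phi> \<in> ring_hom (hecke q) ring_of_type_algebra.
     \<phi> \<in> extensional (carrier (hecke q)) \<and>
     (\<forall>c. \<forall>h\<in>carrier (hecke q). \<phi> (hecke_smult q c h) = c * \<phi> h)}"

end

theory Submission
  imports Defs
begin

text \<open>
  In a one-dimensional representation everything commutes, so write \<open>t\<^sub>i\<close> for the value of \<open>T\<^sub>i\<close>
  and \<open>x\<close> for the character of the lattice by which the \<open>X\<^sup>\<lambda>\<close> act. The quadratic relation says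
  \<open>(t\<^sub>i - q) (t\<^sub>i + q\<inverse>) = 0\<close>, equivalently \<open>t\<^sub>i - t\<^sub>i\<inverse> = q - q\<inverse>\<close>. The Bernstein relation at \<open>\<omega>\<^sub>i\<close>,
  where the pairing is \<open>1\<close> and the quotient is just \<open>X\<^bsup>\<omega>\<^sub>i\<^esup>\<close>, becomes
  \<open>t\<^sub>i = t\<^sub>i x(-\<alpha>\<^sub>i) + (q - q\<inverse>)\<close>, which forces \<open>x(\<alpha>\<^sub>i) = t\<^sub>i\<^sup>2\<close>. The simple roots span the weight
  lattice, so \<open>(t\<^sub>1, t\<^sub>2)\<close> determines the whole representation (\<open>rep_values\<close>), and expressing the
  fundamental weights in simple roots gives \<open>t\<^sub>1\<^sup>4 t\<^sub>2\<^sup>2\<close> and \<open>t\<^sub>1\<^sup>6 t\<^sub>2\<^sup>4\<close> as the values of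
  \<open>X\<^bsup>\<omega>\<^sub>1\<^esup>\<close> and \<open>X\<^bsup>\<omega>\<^sub>2\<^esup>\<close>.

  Conversely each choice of \<open>t\<^sub>1, t\<^sub>2\<close> in \<open>{q, -q\<inverse>}\<close> occurs (\<open>rep_exists\<close>). The braid relation holds
  because both sides become \<open>t\<^sub>1\<^sup>3 t\<^sub>2\<^sup>3\<close>. For the Bernstein relation let \<open>B\<close> be the value of the
  quotient; then \<open>B (1 - x(-\<alpha>\<^sub>i)) = x(\<lambda>) - x(s\<^sub>i\<lambda>)\<close>, and multiplying by \<open>t\<^sub>i\<close> gives the relation
  since \<open>t\<^sub>i (1 - x(-\<alpha>\<^sub>i)) = t\<^sub>i - t\<^sub>i\<inverse> = q - q\<inverse>\<close>. No division by \<open>1 - x(-\<alpha>\<^sub>i)\<close> occurs, so the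
  argument covers \<open>q\<^sup>2 = 1\<close>. When \<open>q\<^sup>2 = -1\<close> the two choices of each \<open>t\<^sub>i\<close> coincide, and so do the
  corresponding representations.

  These computations take place in the free algebra: representations of the Hecke algebra are
  the same as algebra homomorphisms from the free algebra that kill the relations
  (\<open>alg_hom_of_rep\<close>, \<open>rep_of_alg_hom\<close>). Both the free algebra and the group algebra of the lattice
  are monoid algebras, on which characters of the monoid extend linearly (\<open>char_lin_mult\<close>).
\<close>

section \<open>Linear extension of characters to monoid algebras\<close>

definition char_lin :: "('a \<Rightarrow> complex) \<Rightarrow> ('a \<Rightarrow>\<^sub>0 complex) \<Rightarrow> complex" where
  "char_lin m f = (\<Sum>k\<in>Poly_Mapping.keys f. Poly_Mapping.lookup f k * m k)"

lemma char_lin_zero [simp]: "char_lin m 0 = 0"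
  by (simp add: char_lin_def)

lemma char_lin_single [simp]: "char_lin m (Poly_Mapping.single k c) = c * m k"
  by (simp add: char_lin_def)

lemma char_lin_superset:
  assumes "finite A" "Poly_Mapping.keys f \<subseteq> A"
  shows "char_lin m f = (\<Sum>k\<in>A. Poly_Mapping.lookup f k * m k)"
  unfolding char_lin_def by (rule sum.mono_neutral_left) (use assms in \<open>auto simp: in_keys_iff\<close>)

lemma char_lin_add [simp]: "char_lin m (f + g) = char_lin m f + char_lin m g"
proof -
  let ?A = "Poly_Mapping.keys f \<union> Poly_Mapping.keys g"
  have "char_lin m h = (\<Sum>k\<in>?A. Poly_Mapping.lookup h k * m k)" if "h \<in> {f, g, f + g}" for h
    using that Poly_Mapping.keys_add[of f g] by (intro char_lin_superset) auto
  then show ?thesis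
    by (simp add: lookup_add distrib_right sum.distrib)
qed

lemma char_lin_diff: "char_lin m (f - g) = char_lin m f - char_lin m g"
  using char_lin_add[of m "f - g" g] by simp

lemma poly_mapping_additive_induct [case_names zero single add]:
  assumes "P 0" "\<And>k c. P (Poly_Mapping.single k c)" "\<And>f g. P f \<Longrightarrow> P g \<Longrightarrow> P (f + g)"
  shows "P f"
proof (induction f rule: update_induct)
  case const
  show ?case by (rule assms(1))
next
  case (update f a b)
  have "Poly_Mapping.update a b f = f + Poly_Mapping.single a b"
    using update.hyps
    by (intro poly_mapping_eqI) (auto simp: lookup_update lookup_add lookup_single when_def in_keys_iff)
  then show ?case using assms(2,3) update.IH by simp
qed

text \<open>Both sides are biadditive in \<open>f\<close> and \<open>g\<close>, so only monomials have to be compared. The lemma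
  serves both for words under concatenation and for weights.\<close>

lemma char_lin_mult:
  fixes m :: "'a :: monoid_add \<Rightarrow> complex"
  assumes m: "\<And>a b. m (a + b) = m a * m b"
  shows "char_lin m (f * g) = char_lin m f * char_lin m g"
proof (induction f rule: poly_mapping_additive_induct)
  case (single k c)
  show ?case
    by (induction g rule: poly_mapping_additive_induct) (simp_all add: mult_single m distrib_left)
qed (simp_all add: distrib_right)

section \<open>Algebra homomorphisms out of the Hecke algebra\<close>

text \<open>Unitality and linearity are contained in the last clause: \<open>scal 1\<close> is the unit of the free
  algebra, and scaling by \<open>c\<close> is multiplication by \<open>scal c\<close>.\<close>

definition alg_hom :: "(free_alg \<Rightarrow> complex) \<Rightarrow> bool" where
  "alg_hom \<psi> \<longleftrightarrow> 
     (\<forall>x y. \<psi> (x + y) = \<psi> x + \<psi> y) \<and> (\<forall>x y. \<psi> (x * y) = \<psi> x * \<psi> y) \<and> (\<forall>c. \<psi> (scal c) = c)"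

lemma scal_1: "scal 1 = 1"
  by (simp add: scal_def flip: zero_list_def)

lemma alg_homD:
  assumes "alg_hom \<psi>"
  shows "\<psi> (x + y) = \<psi> x + \<psi> y" "\<psi> (x * y) = \<psi> x * \<psi> y" "\<psi> (scal c) = c"
    "\<psi> 1 = 1" "\<psi> 0 = 0" "\<psi> (x - y) = \<psi> x - \<psi> y"
proof -
  show add: "\<psi> (x + y) = \<psi> x + \<psi> y" and "\<psi> (x * y) = \<psi> x * \<psi> y"
    and s: "\<psi> (scal c) = c" for x y c
    using assms by (auto simp: alg_hom_def)
  show "\<psi> 1 = 1" using s[of 1] by (simp add: scal_1)
  show "\<psi> 0 = 0" using add[of 0 0] by simp
  show "\<psi> (x - y) = \<psi> x - \<psi> y" using add[of "x - y" y] by simp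
qed

text \<open>Transfers the Bernstein quotient, which is computed in the commutative group algebra, to the
  free algebra.\<close>

lemma alg_hom_fX_lin:
  assumes "alg_hom \<psi>"
  shows "\<psi> (fX_lin f) = char_lin (\<lambda>\<mu>. \<psi> (fX \<mu>)) f"
proof -
  have "\<psi> (sum g A) = (\<Sum>a\<in>A. \<psi> (g a))" for g and A :: "weight set"
    by (induction A rule: infinite_finite_induct) (simp_all add: alg_homD[OF assms])
  then show ?thesis
    by (simp add: fX_lin_def char_lin_def alg_homD[OF assms])
qed

text \<open>The monomials with coefficient \<open>1\<close> are products of generators, and every element is a linear
  combination of monomials.\<close>

lemma alg_hom_eqI:
  assumes \<psi>: "alg_hom \<psi>" and \<psi>': "alg_hom \<psi>'"
    and T: "\<And>i. \<psi> (fT i) = \<psi>' (fT i)" and X: "\<And>\<mu>. \<psi> (fX \<mu>) = \<psi>' (fX \<mu>)"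
  shows "\<psi> = \<psi>'"
proof
  fix f
  have word: "\<psi> (Poly_Mapping.single w 1) = \<psi>' (Poly_Mapping.single w 1)" for w
  proof (induction w)
    case Nil
    show ?case
      using alg_homD(4)[OF \<psi>] alg_homD(4)[OF \<psi>'] by (simp flip: zero_list_def)
  next
    case (Cons g w)
    have split: "Poly_Mapping.single (g # w) 1
        = Poly_Mapping.single [g] 1 * (Poly_Mapping.single w 1 :: free_alg)"
      by (simp add: mult_single plus_list_def)
    have "\<psi> (Poly_Mapping.single [g] 1) = \<psi>' (Poly_Mapping.single [g] 1)"
      using T X by (cases g) (auto simp: fT_def fX_def)
    with Cons show ?case
      unfolding split by (simp add: alg_homD(2)[OF \<psi>] alg_homD(2)[OF \<psi>'])
  qed
  show "\<psi> f = \<psi>' f"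
  proof (induction f rule: poly_mapping_additive_induct)
    case zero
    show ?case by (simp add: alg_homD(5)[OF \<psi>] alg_homD(5)[OF \<psi>'])
  next
    case (single w c)
    have "Poly_Mapping.single w c = scal c * Poly_Mapping.single w 1"
      by (simp add: scal_def mult_single plus_list_def)
    then show ?case
      by (simp add: word alg_homD(2,3)[OF \<psi>] alg_homD(2,3)[OF \<psi>'])
  next
    case (add f g)
    then show ?case by (simp add: alg_homD(1)[OF \<psi>] alg_homD(1)[OF \<psi>'])
  qed
qed

lemma ring_of_type_algebra_simps:
  "carrier ring_of_type_algebra = UNIV"
  "x \<oplus>\<^bsub>ring_of_type_algebra\<^esub> y = x + y"
  "x \<otimes>\<^bsub>ring_of_type_algebra\<^esub> y = x * y"
  "\<one>\<^bsub>ring_of_type_algebra\<^esub> = 1"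
  "\<zero>\<^bsub>ring_of_type_algebra\<^esub> = 0"
  by (simp_all add: ring_of_type_algebra_def)

text \<open>The free algebra is not commutative, so the ring axioms are needed for \<open>ring_1\<close>.\<close>

lemma ring_of_type_algebra_ring:
  "ring (ring_of_type_algebra :: 'a :: ring_1 ring)"
proof -
  have "\<exists>y. x + y = 0" for x :: 'a
    using add.right_inverse by blast
  then show ?thesis
    unfolding ring_of_type_algebra_def
    by unfold_locales (auto simp: algebra_simps Units_def)
qed

lemma hecke_ideal: "ideal (hecke_ideal q) free_alg_ring"
  unfolding hecke_ideal_def
  by (rule ring.genideal_ideal[OF ring_of_type_algebra_ring]) (simp add: ring_of_type_algebra_simps)

lemma hecke_rels_subset_ideal: "hecke_rels q \<subseteq> hecke_ideal q"
  unfolding hecke_ideal_def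
  by (rule ring.genideal_self[OF ring_of_type_algebra_ring]) (simp add: ring_of_type_algebra_simps)

lemma hecke_class_hom: "hecke_class q \<in> ring_hom free_alg_ring (hecke q)"
proof -
  have "hecke_class q = (+>\<^bsub>free_alg_ring\<^esub>) (hecke_ideal q)"
    by (rule ext) (simp add: hecke_class_def)
  then show ?thesis
    using ideal.rcos_ring_hom[OF hecke_ideal] by (simp add: hecke_def)
qed

lemma hecke_class_add: "hecke_class q x \<oplus>\<^bsub>hecke q\<^esub> hecke_class q y = hecke_class q (x + y)"
  and hecke_class_mult: "hecke_class q x \<otimes>\<^bsub>hecke q\<^esub> hecke_class q y = hecke_class q (x * y)"
  and hecke_class_one: "hecke_class q 1 = \<one>\<^bsub>hecke q\<^esub>"
  using ring_hom_add[OF hecke_class_hom, of x y q] ring_hom_mult[OF hecke_class_hom, of x y q]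
    ring_hom_one[OF hecke_class_hom, of q]
  by (simp_all add: ring_of_type_algebra_simps)

lemma carrier_hecke: "carrier (hecke q) = range (hecke_class q)"
  by (auto simp: hecke_def FactRing_def A_RCOSETS_defs hecke_class_def a_r_coset_def
      ring_of_type_algebra_simps)

lemma hecke_class_eq_iff: "hecke_class q x = hecke_class q y \<longleftrightarrow> x - y \<in> hecke_ideal q"
proof -
  interpret I: ideal "hecke_ideal q" free_alg_ring
    by (rule hecke_ideal)
  have 1: "hecke_class q x = {a + x | a. a \<in> hecke_ideal q}" for x
    by (auto simp: hecke_class_def a_r_coset_def' ring_of_type_algebra_simps)
  have add: "a + b \<in> hecke_ideal q" if "a \<in> hecke_ideal q" "b \<in> hecke_ideal q" for a b
    using subgroup.m_closed[OF I.a_subgroup that] by (simp add: ring_of_type_algebra_simps)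
  have zero: "0 \<in> hecke_ideal q"
    using subgroup.one_closed[OF I.a_subgroup] by (simp add: ring_of_type_algebra_simps)
  have minus: "- a \<in> hecke_ideal q" if "a \<in> hecke_ideal q" for a
    using I.I_l_closed[OF that, of "- 1"] by (simp add: ring_of_type_algebra_simps)
  show ?thesis
  proof
    assume "hecke_class q x = hecke_class q y"
    moreover have "x \<in> hecke_class q x" using zero by (force simp: 1)
    ultimately obtain a where "a \<in> hecke_ideal q" "x = a + y" by (auto simp: 1)
    then show "x - y \<in> hecke_ideal q" by simp
  next
    assume d: "x - y \<in> hecke_ideal q"
    have "a + x = (a + (x - y)) + y" "a + y = (a + - (x - y)) + x" for a by simp_all
    then show "hecke_class q x = hecke_class q y"
      unfolding 1 using add[OF _ d] add[OF _ minus[OF d]] by blast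
  qed
qed

text \<open>Pulled back along the quotient map, a representation becomes a homomorphism on the free
  algebra, where the defining relations can be read as equations between complex numbers.\<close>

lemma alg_hom_of_rep:
  assumes "\<phi> \<in> one_dim_reps q"
  shows "alg_hom (\<lambda>x. \<phi> (hecke_class q x))"
    and "\<And>r. r \<in> hecke_rels q \<Longrightarrow> \<phi> (hecke_class q r) = 0"
proof -
  have hom: "\<phi> \<in> ring_hom (hecke q) ring_of_type_algebra"
    and smult: "\<And>c x. \<phi> (hecke_smult q c (hecke_class q x)) = c * \<phi> (hecke_class q x)"
    using assms by (auto simp: one_dim_reps_def carrier_hecke)
  have one: "\<phi> (hecke_class q 1) = 1"
    using ring_hom_one[OF hom] by (simp add: hecke_class_one ring_of_type_algebra_simps)
  have "\<phi> (hecke_class q (scal c)) = c" for c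
    using smult[of c 1] by (simp add: hecke_smult_def hecke_class_mult one)
  moreover have "\<phi> (hecke_class q (x + y)) = \<phi> (hecke_class q x) + \<phi> (hecke_class q y)"
    and "\<phi> (hecke_class q (x * y)) = \<phi> (hecke_class q x) * \<phi> (hecke_class q y)" for x y
    using ring_hom_add[OF hom, of "hecke_class q x" "hecke_class q y"]
      ring_hom_mult[OF hom, of "hecke_class q x" "hecke_class q y"]
    by (simp_all add: carrier_hecke hecke_class_add hecke_class_mult ring_of_type_algebra_simps)
  ultimately show alg: "alg_hom (\<lambda>x. \<phi> (hecke_class q x))"
    by (simp add: alg_hom_def)
  fix r assume "r \<in> hecke_rels q"
  then have "hecke_class q r = hecke_class q 0"
    using hecke_rels_subset_ideal by (auto simp: hecke_class_eq_iff)
  then show "\<phi> (hecke_class q r) = 0"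
    using alg_homD(5)[OF alg] by simp
qed

text \<open>The kernel is an ideal containing the relations, hence contains the ideal they generate.\<close>

lemma alg_hom_vanishes_on_ideal:
  assumes \<psi>: "alg_hom \<psi>" and rels: "\<And>r. r \<in> hecke_rels q \<Longrightarrow> \<psi> r = 0"
    and "z \<in> hecke_ideal q"
  shows "\<psi> z = 0"
proof -
  have "\<psi> \<in> ring_hom free_alg_ring ring_of_type_algebra"
    by (rule ring_hom_memI) (simp_all add: ring_of_type_algebra_simps alg_homD[OF \<psi>])
  then have hom: "ring_hom_ring free_alg_ring ring_of_type_algebra \<psi>"
    by (rule ring_hom_ringI2[OF ring_of_type_algebra_ring ring_of_type_algebra_ring])
  have "hecke_ideal q \<subseteq> a_kernel free_alg_ring ring_of_type_algebra \<psi>"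
    unfolding hecke_ideal_def
    by (rule ring.genideal_minimal[OF ring_of_type_algebra_ring ring_hom_ring.kernel_is_ideal[OF hom]])
      (auto simp: a_kernel_def' ring_of_type_algebra_simps rels)
  with assms(3) show ?thesis
    by (auto simp: a_kernel_def' ring_of_type_algebra_simps)
qed

text \<open>The universal property of the quotient: the value on a coset is read off at an arbitrary
  representative, and two representatives differ by an element of the ideal, where \<open>\<psi>\<close> vanishes.\<close>

lemma rep_of_alg_hom:
  assumes \<psi>: "alg_hom \<psi>" and rels: "\<And>r. r \<in> hecke_rels q \<Longrightarrow> \<psi> r = 0"
  obtains \<phi> where "\<phi> \<in> one_dim_reps q" "\<And>x. \<phi> (hecke_class q x) = \<psi> x"
proof
  \<comment> \<open>Restricting to the carrier makes the map extensional, as \<open>one_dim_reps\<close> demands.\<close>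
  let ?\<phi> = "restrict (\<lambda>h. \<psi> (inv_into UNIV (hecke_class q) h)) (carrier (hecke q))"
  show \<phi>: "?\<phi> (hecke_class q x) = \<psi> x" for x
  proof -
    let ?y = "inv_into UNIV (hecke_class q) (hecke_class q x)"
    have "hecke_class q ?y = hecke_class q x" by (simp add: f_inv_into_f)
    then have "\<psi> (?y - x) = 0"
      by (intro alg_hom_vanishes_on_ideal[OF \<psi> rels]) (auto simp: hecke_class_eq_iff)
    then show ?thesis by (simp add: carrier_hecke alg_homD[OF \<psi>])
  qed
  have "?\<phi> \<in> ring_hom (hecke q) ring_of_type_algebra"
    by (rule ring_hom_memI)
      (auto simp: carrier_hecke hecke_class_add hecke_class_mult ring_of_type_algebra_simps
        alg_homD[OF \<psi>] \<phi>[unfolded carrier_hecke] simp del: restrict_apply restrict_apply'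
        simp flip: hecke_class_one)
  moreover have "?\<phi> (hecke_smult q c h) = c * ?\<phi> h" if "h \<in> carrier (hecke q)" for c h
    using that unfolding carrier_hecke
    by (auto simp: hecke_smult_def hecke_class_mult alg_homD[OF \<psi>] \<phi>[unfolded carrier_hecke]
        simp del: restrict_apply restrict_apply')
  ultimately show "?\<phi> \<in> one_dim_reps q"
    by (simp add: one_dim_reps_def del: restrict_apply restrict_apply')
qed

lemma rep_eqI:
  assumes "\<phi> \<in> one_dim_reps q" "\<phi>' \<in> one_dim_reps q"
    and "\<And>i. \<phi> (hecke_T q i) = \<phi>' (hecke_T q i)" "\<And>\<mu>. \<phi> (hecke_X q \<mu>) = \<phi>' (hecke_X q \<mu>)"
  shows "\<phi> = \<phi>'"
proof -
  have "(\<lambda>x. \<phi> (hecke_class q x)) = (\<lambda>x. \<phi>' (hecke_class q x))"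
    by (rule alg_hom_eqI)
      (use assms in \<open>simp_all add: alg_hom_of_rep hecke_T_def hecke_X_def\<close>)
  then have "\<phi> h = \<phi>' h" if "h \<in> carrier (hecke q)" for h
    using that by (auto simp: carrier_hecke dest: fun_cong)
  then show ?thesis
    using assms(1,2) by (intro extensionalityI[of _ "carrier (hecke q)"]) (auto simp: one_dim_reps_def)
qed

section \<open>The one-dimensional representations\<close>

lemma hecke_eigenvalue_iff:
  fixes q t :: complex
  assumes "q \<noteq> 0"
  shows "t * t = (q - inverse q) * t + 1 \<longleftrightarrow> t \<in> {q, - inverse q}"
proof -
  have "t * t - ((q - inverse q) * t + 1) = (t - q) * (t + inverse q)"
    using assms by (simp add: algebra_simps)
  then show ?thesis
    by (metis add_eq_0_iff2 eq_iff_diff_eq_0 insert_iff mult_eq_0_iff singletonD)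
qed

text \<open>Since \<open>s\<^sub>i\<omega>\<^sub>i = \<omega>\<^sub>i - \<alpha>\<^sub>i\<close>, the numerator \<open>X\<^bsup>\<omega>\<^sub>i\<^esup> - X\<^bsup>s\<^sub>i\<omega>\<^sub>i\<^esup>\<close> is \<open>X\<^bsup>\<omega>\<^sub>i\<^esup>\<close> times the
  denominator. This makes \<open>\<omega>\<^sub>i\<close> the weight at which the Bernstein relation is most easily
  evaluated.\<close>

lemma bl_quot_fund_weight: "bl_quot i (fund_weight i) = Xga (fund_weight i)"
proof -
  have "simple_refl i (fund_weight i) = fund_weight i + - simple_root i"
    by (cases i) (simp_all add: simple_refl_def wscale_def)
  then have "Xga (fund_weight i) * (1 - Xga (- simple_root i))
      = Xga (fund_weight i) - Xga (simple_refl i (fund_weight i))"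
    by (simp only: Xga_add right_diff_distrib mult_1_right)
  then show ?thesis
    using bl_quot bl_quot_ex1 by blast
qed

text \<open>The character of the lattice with \<open>\<alpha>\<^sub>i \<mapsto> t\<^sub>i\<^sup>2\<close>; weights are given by their coordinates in
  the simple roots.\<close>

definition lattice_char :: "(node \<Rightarrow> complex) \<Rightarrow> weight \<Rightarrow> complex" where
  "lattice_char t \<mu> = t N1 powi (2 * fst \<mu>) * t N2 powi (2 * snd \<mu>)"

lemma lattice_char_hom:
  assumes "\<And>i. t i \<noteq> 0"
  shows "lattice_char t 0 = 1" "lattice_char t (\<mu> + \<nu>) = lattice_char t \<mu> * lattice_char t \<nu>"
  using assms by (simp_all add: lattice_char_def power_int_add distrib_left)

lemma lattice_char_fund_weight:
  "lattice_char t (fund_weight N1) = t N1 ^ 4 * t N2 ^ 2"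
  "lattice_char t (fund_weight N2) = t N1 ^ 6 * t N2 ^ 4"
  by (simp_all add: lattice_char_def)

text \<open>The simple roots generate the lattice. Negative coordinates are handled through
  \<open>x (- \<alpha>) = inverse (x \<alpha>)\<close>.\<close>

lemma lattice_char_unique:
  fixes x :: "weight \<Rightarrow> complex"
  assumes x0: "x 0 = 1" and x_add: "\<And>\<mu> \<nu>. x (\<mu> + \<nu>) = x \<mu> * x \<nu>"
    and root: "\<And>i. x (simple_root i) = (t i)\<^sup>2"
  shows "x = lattice_char t"
proof
  fix \<mu> :: weight
  obtain a b where \<mu>: "\<mu> = (a, b)" by (cases \<mu>)
  have pow: "x (wscale n \<alpha>) = x \<alpha> powi n" for n \<alpha>
  proof -
    have inv: "x \<alpha> * x (- \<alpha>) = 1" using x_add[of \<alpha> "- \<alpha>"] x0 by simp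
    then have ne: "x \<alpha> \<noteq> 0" by auto
    have nat: "x (wscale (int k) \<beta>) = x \<beta> ^ k" for k \<beta>
    proof (induction k)
      case 0
      show ?case using x0 by (simp add: wscale_def zero_prod_def)
    next
      case (Suc k)
      have "wscale (int (Suc k)) \<beta> = \<beta> + wscale (int k) \<beta>"
        by (cases \<beta>) (simp add: wscale_def algebra_simps)
      with Suc show ?case by (simp add: x_add)
    qed
    show ?thesis
    proof (cases "n \<ge> 0")
      case True
      then show ?thesis using nat[of "nat n" \<alpha>] by (simp add: power_int_def)
    next
      case False
      have "wscale n \<alpha> = wscale (int (nat (- n))) (- \<alpha>)"
        using False by (cases \<alpha>) (simp add: wscale_def)
      moreover have "x (- \<alpha>) = inverse (x \<alpha>)"
        using inv by (simp add: inverse_unique)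
      ultimately show ?thesis
        using False nat[of "nat (- n)" "- \<alpha>"] by (simp add: power_int_def)
    qed
  qed
  have "\<mu> = wscale a (simple_root N1) + wscale b (simple_root N2)"
    by (simp add: \<mu> wscale_def)
  then have "x \<mu> = (t N1)\<^sup>2 powi a * (t N2)\<^sup>2 powi b"
    by (simp only: x_add pow root)
  then show "x \<mu> = lattice_char t \<mu>"
    by (simp add: \<mu> lattice_char_def power_int_mult)
qed

text \<open>The necessary conditions: the quadratic relation restricts each \<open>t\<^sub>i\<close> to two values, and the
  Bernstein relation at \<open>\<omega>\<^sub>i\<close> fixes the character on \<open>\<alpha>\<^sub>i\<close>. In particular the values on \<open>T\<^sub>1\<close> and
  \<open>T\<^sub>2\<close> determine the representation.\<close>

lemma rep_values:
  assumes "q \<noteq> 0" and \<phi>: "\<phi> \<in> one_dim_reps q"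
  defines "t \<equiv> \<lambda>i. \<phi> (hecke_T q i)"
  shows "t i \<in> {q, - inverse q}" and "\<phi> (hecke_X q \<mu>) = lattice_char t \<mu>"
proof -
  define \<psi> where "\<psi> x = \<phi> (hecke_class q x)" for x
  define x where "x \<mu> = \<psi> (fX \<mu>)" for \<mu>
  have \<psi>: "alg_hom \<psi>" and rels: "\<And>r. r \<in> hecke_rels q \<Longrightarrow> \<psi> r = 0"
    using alg_hom_of_rep[OF \<phi>] by (simp_all add: \<psi>_def[abs_def])
  have t: "\<psi> (fT i) = t i" for i by (simp add: t_def \<psi>_def hecke_T_def)
  have x0: "x 0 = 1"
    using rels[OF hecke_rels.X_zero] by (simp add: x_def alg_homD[OF \<psi>])
  have x_add: "x (\<mu> + \<nu>) = x \<mu> * x \<nu>" for \<mu> \<nu>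
    using rels[OF hecke_rels.X_add[of \<mu> \<nu>]] by (simp add: x_def alg_homD[OF \<psi>])
  have quad: "t i * t i = (q - inverse q) * t i + 1" for i
    using rels[OF hecke_rels.quadratic[of i]] by (simp add: t alg_homD[OF \<psi>])
  then show "t i \<in> {q, - inverse q}"
    using hecke_eigenvalue_iff assms(1) by blast
  have "x (simple_root i) = (t i)\<^sup>2" for i
  proof -
    let ?\<omega> = "fund_weight i" and ?\<alpha> = "simple_root i"
    have reflect: "simple_refl i ?\<omega> + ?\<alpha> = ?\<omega>"
      by (cases i) (simp_all add: simple_refl_def wscale_def)
    have "x ?\<omega> * x (- ?\<omega>) = 1" using x_add[of ?\<omega> "- ?\<omega>"] x0 by simp
    then have ne: "x ?\<omega> \<noteq> 0" by auto
    have "\<psi> (fX_lin (bl_quot i ?\<omega>)) = x ?\<omega>"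
      by (simp add: alg_hom_fX_lin[OF \<psi>] bl_quot_fund_weight Xga_def x_def)
    then have "x ?\<omega> * (t i - (q - inverse q)) = t i * x (simple_refl i ?\<omega>)"
      using rels[OF hecke_rels.bernstein[of ?\<omega> i]]
      by (simp add: t x_def alg_homD[OF \<psi>] algebra_simps)
    \<comment> \<open>The factor \<open>t\<^sub>i - (q - q\<inverse>)\<close> is the inverse of \<open>t\<^sub>i\<close>. Multiplying by \<open>t\<^sub>i x(\<alpha>\<^sub>i)\<close> cancels it
      and turns \<open>x(s\<^sub>i\<omega>\<^sub>i)\<close> back into \<open>x(\<omega>\<^sub>i)\<close>.\<close>
    then have "x ?\<omega> * (t i - (q - inverse q)) * (t i * x ?\<alpha>)
        = t i * x (simple_refl i ?\<omega>) * (t i * x ?\<alpha>)"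
      by (rule arg_cong)
    moreover have "(t i - (q - inverse q)) * t i = 1"
      using quad[of i] by (simp add: left_diff_distrib)
    moreover have "x (simple_refl i ?\<omega>) * x ?\<alpha> = x ?\<omega>"
      using x_add[of "simple_refl i ?\<omega>" ?\<alpha>] by (simp only: reflect)
    ultimately have "x ?\<omega> * x ?\<alpha> = x ?\<omega> * (t i)\<^sup>2"
      by (metis (no_types) mult.assoc mult.commute mult_1 power2_eq_square)
    then show ?thesis
      using ne by simp
  qed
  then have "x = lattice_char t"
    by (intro lattice_char_unique[of x t] x0 x_add)
  then show "\<phi> (hecke_X q \<mu>) = lattice_char t \<mu>"
    by (metis x_def \<psi>_def hecke_X_def)
qed

fun gen_value :: "(node \<Rightarrow> complex) \<Rightarrow> gen \<Rightarrow> complex" where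
  "gen_value t (GT i) = t i"
| "gen_value t (GX \<mu>) = lattice_char t \<mu>"

text \<open>The candidate multiplies the prescribed values of the letters of a word and extends linearly.
  The only relation that is not immediate is the Bernstein relation, which follows from
  \<open>t\<^sub>i (1 - x(-\<alpha>\<^sub>i)) = q - q\<inverse>\<close>.\<close>

lemma rep_exists:
  assumes "q \<noteq> 0" and t: "\<And>i. t i \<in> {q, - inverse q}"
  shows "\<exists>\<phi>\<in>one_dim_reps q. \<forall>i. \<phi> (hecke_T q i) = t i"
proof -
  define \<psi> :: "free_alg \<Rightarrow> complex" where "\<psi> = char_lin (\<lambda>w. prod_list (map (gen_value t) w))"
  have \<psi>: "alg_hom \<psi>"
    by (simp add: alg_hom_def \<psi>_def char_lin_mult plus_list_def scal_def)
  have T: "\<psi> (fT i) = t i" and X: "\<psi> (fX \<mu>) = lattice_char t \<mu>" for i \<mu>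
    by (simp_all add: \<psi>_def fT_def fX_def)
  have ne: "t i \<noteq> 0" for i using t[of i] assms(1) by auto
  have quad: "t i * t i = (q - inverse q) * t i + 1" for i
    using t[of i] hecke_eigenvalue_iff[OF assms(1)] by blast
  have bern: "lattice_char t \<mu> * t i
      = t i * lattice_char t (simple_refl i \<mu>) + (q - inverse q) * char_lin (lattice_char t) (bl_quot i \<mu>)"
    for \<mu> i
  proof -
    let ?x = "lattice_char t" and ?B = "char_lin (lattice_char t) (bl_quot i \<mu>)"
    have one: "char_lin ?x 1 = 1"
      using lattice_char_hom(1)[OF ne] by (simp flip: single_one)
    have "?B * (1 - ?x (- simple_root i)) = ?x \<mu> - ?x (simple_refl i \<mu>)"
      using arg_cong[OF bl_quot[of i \<mu>], of "char_lin ?x"]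
      by (simp add: char_lin_mult lattice_char_hom(2)[OF ne] char_lin_diff one Xga_def)
    moreover have "t i * (1 - ?x (- simple_root i)) = q - inverse q"
    proof -
      have "?x (- simple_root i) * (t i * t i) = 1"
        using ne[of i] by (cases i) (simp_all add: lattice_char_def power_int_minus flip: power2_eq_square)
      then have "t i * t i * (t i * (1 - ?x (- simple_root i))) = t i * (t i * t i - 1)"
        by (simp add: algebra_simps)
      also have "\<dots> = t i * t i * (q - inverse q)"
        by (simp add: quad)
      finally show ?thesis using ne by simp
    qed
    ultimately have "(q - inverse q) * ?B = t i * (?x \<mu> - ?x (simple_refl i \<mu>))"
      by (metis mult.assoc mult.commute)
    then show ?thesis by (simp add: algebra_simps)
  qed
  have "\<psi> r = 0" if "r \<in> hecke_rels q" for r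
    using that
  proof cases
    case (quadratic i)
    then show ?thesis by (simp add: alg_homD[OF \<psi>] T quad)
  next
    case (bernstein \<mu> i)
    then show ?thesis by (simp add: alg_homD[OF \<psi>] T X alg_hom_fX_lin[OF \<psi>] bern)
  qed (simp_all add: alg_homD[OF \<psi>] T X lattice_char_hom[OF ne])
  then obtain \<phi> where "\<phi> \<in> one_dim_reps q" "\<And>x. \<phi> (hecke_class q x) = \<psi> x"
    using rep_of_alg_hom[OF \<psi>] by blast
  then show ?thesis
    by (intro bexI[of _ \<phi>]) (simp_all add: hecke_T_def T)
qed

theorem theorem23:
  fixes q :: complex
  assumes "q \<noteq> 0"
  shows "bij_betw
    (\<lambda>\<phi>. (\<phi> (hecke_T q N1), \<phi> (hecke_T q N2),
          \<phi> (hecke_X q (fund_weight N1)), \<phi> (hecke_X q (fund_weight N2))))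
    (one_dim_reps q)
    {(q, q, q ^ 6, q ^ 10),
     (q, - inverse q, q ^ 2, q ^ 2),
     (- inverse q, q, q powi (-2), q powi (-2)),
     (- inverse q, - inverse q, q powi (-6), q powi (-10))}"
  (is "bij_betw ?F _ ?V")
proof (rule bij_betw_imageI)
  show "inj_on ?F (one_dim_reps q)"
  proof (rule inj_onI)
    fix \<phi> \<phi>' assume \<phi>: "\<phi> \<in> one_dim_reps q" and \<phi>': "\<phi>' \<in> one_dim_reps q" and eq: "?F \<phi> = ?F \<phi>'"
    then have T: "\<phi> (hecke_T q i) = \<phi>' (hecke_T q i)" for i by (cases i) auto
    then show "\<phi> = \<phi>'"
      by (intro rep_eqI[OF \<phi> \<phi>'])
        (simp_all add: rep_values(2)[OF assms \<phi>] rep_values(2)[OF assms \<phi>'])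
  qed
next
  let ?E = "{q, - inverse q}"
  have F: "?F \<phi> = (a, b, a ^ 4 * b ^ 2, a ^ 6 * b ^ 4)"
    if "\<phi> \<in> one_dim_reps q" "a = \<phi> (hecke_T q N1)" "b = \<phi> (hecke_T q N2)" for \<phi> a b
    using that(2,3) by (simp only: rep_values(2)[OF assms that(1)] lattice_char_fund_weight)
  \<comment> \<open>The listed quadruples are the points \<open>(a, b, a\<^sup>4b\<^sup>2, a\<^sup>6b\<^sup>4)\<close> with \<open>a\<close> and \<open>b\<close> chosen independently
    in \<open>{q, -q\<inverse>}\<close>.\<close>
  have "?F ` one_dim_reps q = (\<lambda>(a, b). (a, b, a ^ 4 * b ^ 2, a ^ 6 * b ^ 4)) ` (?E \<times> ?E)"
    (is "_ = ?R")
  proof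
    show "?F ` one_dim_reps q \<subseteq> ?R"
    proof (rule image_subsetI)
      fix \<phi> assume \<phi>: "\<phi> \<in> one_dim_reps q"
      then have "(\<phi> (hecke_T q N1), \<phi> (hecke_T q N2)) \<in> ?E \<times> ?E"
        using rep_values(1)[OF assms \<phi>] by (intro SigmaI)
      then show "?F \<phi> \<in> ?R"
        unfolding F[OF \<phi> refl refl] by (rule rev_image_eqI) simp
    qed
    show "?R \<subseteq> ?F ` one_dim_reps q"
    proof
      fix v assume "v \<in> ?R"
      then obtain a b where ab: "a \<in> ?E" "b \<in> ?E" and v: "v = (a, b, a ^ 4 * b ^ 2, a ^ 6 * b ^ 4)"
        by auto
      have "case_node a b i \<in> ?E" for i
        using ab by (cases i) simp_all
      then obtain \<phi> where \<phi>: "\<phi> \<in> one_dim_reps q" and T: "\<And>i. \<phi> (hecke_T q i) = case_node a b i"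
        using rep_exists[OF assms, of "case_node a b"] by auto
      have "?F \<phi> = v"
        unfolding v by (rule F[OF \<phi>]) (simp_all add: T)
      then show "v \<in> ?F ` one_dim_reps q"
        using \<phi> by (intro image_eqI[of v ?F \<phi>]) simp_all
    qed
  qed
  also have "\<dots> = ?V"
  proof -
    have "q ^ 4 * (- inverse q) ^ 2 = q ^ 2" "q ^ 6 * (- inverse q) ^ 4 = q ^ 2"
      "(- inverse q) ^ 4 * q ^ 2 = q powi (-2)" "(- inverse q) ^ 6 * q ^ 4 = q powi (-2)"
      "(- inverse q) ^ 4 * (- inverse q) ^ 2 = q powi (-6)"
      "(- inverse q) ^ 6 * (- inverse q) ^ 4 = q powi (-10)"
      using assms by (simp_all add: power_int_minus field_simps eval_nat_numeral)
    moreover have "q ^ 4 * q ^ 2 = q ^ 6" "q ^ 6 * q ^ 4 = q ^ 10"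
      by (simp_all flip: power_add)
    ultimately show ?thesis by simp
  qed
  finally show "?F ` one_dim_reps q = ?V" .
qed

end
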